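(* If $n \geq 3$, then $\mathrm{Aut}(F_n)$ (and hence each of its quotients) is the normal closure of a single element of order $2$.
   Context: $F_n$ denotes the free group of rank $n$ and $\mathrm{Aut}(F_n)$ its automorphism group. The normal closure of an element $g$ of a group $\Gamma$ is the smallest normal subgroup of $\Gamma$ containing $g$.
   Formalization: For quotients, the generating element is asserted to have order 2 only when the quotient is nontrivial, since the trivial quotient has no element of order 2. *)

theory Defs
  imports "HOL-Algebra.Algebra"
begin

section \<open>The free group of rank n\<close>

text \<open>
  The basis elements are indexed by \<open>i < n\<close>. The letter \<open>(i, True)\<close> stands for the basis
  element \<open>x\<^sub>i\<close> and \<open>(i, False)\<close> for its inverse; group elements are freely reduced words.
\<close>

type_synonym letter = "nat \<times> bool"

definition inv_letter :: "letter \<Rightarrow> letter" where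
  "inv_letter a = (fst a, \<not> snd a)"

definition reduced :: "letter list \<Rightarrow> bool" where
  "reduced w \<longleftrightarrow> successively (\<lambda>a b. b \<noteq> inv_letter a) w"

text \<open>Left multiplication of a reduced word by a single letter, with free cancellation.\<close>

definition letter_mult :: "letter \<Rightarrow> letter list \<Rightarrow> letter list" where
  "letter_mult a w =
     (case w of [] \<Rightarrow> [a] | b # v \<Rightarrow> if b = inv_letter a then v else a # w)"

definition word_mult :: "letter list \<Rightarrow> letter list \<Rightarrow> letter list" where
  "word_mult u v = foldr letter_mult u v"

definition free_group :: "nat \<Rightarrow> letter list monoid" where
  "free_group n =
     \<lparr>carrier = {w. reduced w \<and> (\<forall>a\<in>set w. fst a < n)}, monoid.mult = word_mult, one = []\<rparr>"

text \<open>This is a group, generated by and satisfying the universal property of the free group on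
  \<open>x\<^sub>0, \<dots>, x\<^bsub>n-1\<^esub>\<close>.\<close>

lemma inv_letter_invol [simp]: "inv_letter (inv_letter a) = a"
  by (simp add: inv_letter_def)

lemma inv_letter_neq [simp]: "inv_letter a \<noteq> a" "a \<noteq> inv_letter a"
  by (auto simp: inv_letter_def prod_eq_iff)

lemma inv_letter_eq_iff [simp]: "inv_letter a = inv_letter b \<longleftrightarrow> a = b"
  by (metis inv_letter_invol)

lemma fst_inv_letter [simp]: "fst (inv_letter a) = fst a"
  by (simp add: inv_letter_def)

lemma reduced_Nil [simp]: "reduced []"
  by (simp add: reduced_def)

lemma reduced_Cons: "reduced (a # w) \<longleftrightarrow> reduced w \<and> (w = [] \<or> hd w \<noteq> inv_letter a)"
  by (cases w) (auto simp: reduced_def)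

lemma reduced_letter_mult: "reduced w \<Longrightarrow> reduced (letter_mult a w)"
  by (auto simp: letter_mult_def reduced_Cons split: list.split)

lemma letter_mult_reduced: "reduced (a # w) \<Longrightarrow> letter_mult a w = a # w"
  by (auto simp: letter_mult_def reduced_Cons split: list.split)

lemma letter_mult_cancel: "reduced w \<Longrightarrow> letter_mult a (letter_mult (inv_letter a) w) = w"
  by (auto simp: letter_mult_def reduced_Cons split: list.split)

lemma word_mult_simps [simp]:
  "word_mult [] v = v"
  "word_mult (a # u) v = letter_mult a (word_mult u v)"
  by (simp_all add: word_mult_def)

lemma reduced_word_mult: "reduced v \<Longrightarrow> reduced (word_mult u v)"
  by (induction u) (auto simp: reduced_letter_mult)

lemma word_mult_letter_mult:
  assumes "reduced v"
  shows "word_mult (letter_mult a u) v = letter_mult a (word_mult u v)"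
  using letter_mult_cancel[OF reduced_word_mult[OF assms]]
  by (auto simp: letter_mult_def[of a u] split: list.split)

lemma word_mult_assoc:
  "reduced w \<Longrightarrow> word_mult (word_mult u v) w = word_mult u (word_mult v w)"
  by (induction u) (auto simp: word_mult_letter_mult reduced_word_mult)

lemma word_mult_Nil_right: "reduced u \<Longrightarrow> word_mult u [] = u"
  by (induction u) (auto simp: letter_mult_reduced reduced_Cons)

lemma word_mult_left_inverse: "word_mult (rev (map inv_letter u)) u = []"
  by (induction u) (auto simp: word_mult_def letter_mult_def)

lemma reduced_inverse: "reduced u \<Longrightarrow> reduced (rev (map inv_letter u))"
  by (simp add: reduced_def successively_map)
     (erule successively_mono, metis inv_letter_invol)

lemma set_letter_mult: "set (letter_mult a w) \<subseteq> insert a (set w)"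
  by (auto simp: letter_mult_def split: list.splits if_splits)

lemma set_word_mult: "set (word_mult u v) \<subseteq> set u \<union> set v"
  using set_letter_mult by (induction u) fastforce+

lemma group_free_group: "group (free_group n)"
proof (rule groupI)
  show "\<exists>v\<in>carrier (free_group n). v \<otimes>\<^bsub>free_group n\<^esub> u = \<one>\<^bsub>free_group n\<^esub>"
    if "u \<in> carrier (free_group n)" for u
    using that word_mult_left_inverse[of u] reduced_inverse[of u]
    by (intro bexI[of _ "rev (map inv_letter u)"]) (auto simp: free_group_def)
qed (use set_word_mult in \<open>fastforce simp: free_group_def word_mult_assoc reduced_word_mult\<close>)+

lemma free_group_generator: "i < n \<Longrightarrow> [(i, True)] \<in> carrier (free_group n)"
  by (simp add: free_group_def reduced_Cons)

lemma generate_free_group: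
  "generate (free_group n) {[(i, True)] | i. i < n} = carrier (free_group n)" (is "?L = _")
proof -
  interpret F: group "free_group n" by (rule group_free_group)
  have letter: "[(i, b)] \<in> ?L" if "i < n" for i b
  proof (cases b)
    case True
    then show ?thesis using that by (auto intro: generate.incl)
  next
    case False
    have "[(i, False)] = inv\<^bsub>free_group n\<^esub> [(i, True)]"
      by (rule F.inv_equality[symmetric])
         (use that in \<open>auto simp: free_group_def reduced_Cons letter_mult_def inv_letter_def\<close>)
    then show ?thesis
      using False that by (auto intro!: generate.inv)
  qed
  have "w \<in> ?L" if "reduced w" "\<forall>a\<in>set w. fst a < n" for w
    using that
  proof (induction w)
    case Nil
    then show ?case using generate.one[of "free_group n"] by (simp add: free_group_def)
  next
    case (Cons a w)
    then have "[a] \<in> ?L" "w \<in> ?L"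
      using letter[of "fst a" "snd a"] by (auto simp: reduced_Cons)
    then have "[a] \<otimes>\<^bsub>free_group n\<^esub> w \<in> ?L" by (rule generate.eng)
    moreover have "[a] \<otimes>\<^bsub>free_group n\<^esub> w = a # w"
      using Cons.prems by (simp add: free_group_def letter_mult_reduced)
    ultimately show ?case by simp
  qed
  then have "carrier (free_group n) \<subseteq> ?L" by (auto simp: free_group_def)
  moreover have "?L \<subseteq> carrier (free_group n)"
    by (rule F.generate_incl) (auto simp: free_group_generator)
  ultimately show ?thesis by blast
qed

lemma free_group_universal:
  fixes H (structure)
  assumes "group H" and f: "\<And>i. i < n \<Longrightarrow> f i \<in> carrier H"
  shows "\<exists>h\<in>hom (free_group n) H. \<forall>i<n. h [(i, True)] = f i"
proof -
  interpret H: group H by fact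
  define g where "g a = (if snd a then f (fst a) else inv (f (fst a)))" for a :: letter
  define h where "h w = foldr (\<lambda>a y. g a \<otimes> y) w \<one>" for w
  let ?ok = "\<lambda>w. \<forall>a\<in>set w. fst a < n"
  have g: "g a \<in> carrier H" if "fst a < n" for a
    using f that by (auto simp: g_def)
  have ginv: "g (inv_letter a) = inv (g a)" if "fst a < n" for a
    using f that by (auto simp: g_def inv_letter_def)
  have hc: "h w \<in> carrier H" if "?ok w" for w
    using that g by (induction w) (auto simp: h_def)
  have hl: "h (letter_mult a w) = g a \<otimes> h w" if "fst a < n" "?ok w" for a w
  proof (cases "w \<noteq> [] \<and> hd w = inv_letter a")
    case True
    then obtain v where w: "w = inv_letter a # v" by (cases w) auto
    then have "h w = inv (g a) \<otimes> h v" using ginv that by (simp add: h_def)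
    then have "g a \<otimes> h w = h v"
      using g[OF that(1)] hc[of v] that w by (simp add: H.m_assoc[symmetric])
    then show ?thesis using w by (simp add: letter_mult_def)
  next
    case False
    then show ?thesis by (cases w) (auto simp: letter_mult_def h_def)
  qed
  have hm: "h (word_mult u v) = h u \<otimes> h v" if "?ok u" "?ok v" for u v
    using that
  proof (induction u)
    case Nil
    then show ?case using hc[of v] by (simp add: h_def)
  next
    case (Cons a u)
    have "?ok (word_mult u v)" using Cons.prems set_word_mult[of u v] by fastforce
    then have "h (word_mult (a # u) v) = g a \<otimes> h (word_mult u v)" using hl Cons.prems by simp
    also have "\<dots> = g a \<otimes> (h u \<otimes> h v)" using Cons by simp
    also have "\<dots> = h (a # u) \<otimes> h v"
      using g[of a] hc[of u] hc[of v] Cons.prems by (simp add: h_def H.m_assoc)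
    finally show ?case .
  qed
  have "h \<in> hom (free_group n) H"
    using hc hm by (auto simp: hom_def free_group_def)
  moreover have "\<forall>i<n. h [(i, True)] = f i"
    using f by (simp add: h_def g_def)
  ultimately show ?thesis by blast
qed


definition Aut_free_group :: "nat \<Rightarrow> (letter list \<Rightarrow> letter list) monoid" where
  "Aut_free_group n = AutoGroup (free_group n)"

lemma group_Aut_free_group: "group (Aut_free_group n)"
  by (simp add: Aut_free_group_def group.AutoGroup group_free_group)


section \<open>Normal closure of an element\<close>

definition normal_closure :: "('a, 'b) monoid_scheme \<Rightarrow> 'a \<Rightarrow> 'a set" where
  "normal_closure G g = \<Inter> {N. N \<lhd> G \<and> g \<in> N}"

lemma normal_closure_normal:
  assumes "group G" "g \<in> carrier G"
  shows "normal_closure G g \<lhd> G"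
proof -
  interpret group G by fact
  have car: "carrier G \<in> {N. N \<lhd> G \<and> g \<in> N}"
    using assms by (auto simp: normal_inv_iff subgroup_self)
  have "subgroup (normal_closure G g) G"
    unfolding normal_closure_def
    by (rule subgroups_Inter) (use car in \<open>auto simp: normal_imp_subgroup\<close>)
  then show ?thesis
    by (auto simp: normal_inv_iff normal_closure_def)
qed

end

theory Submission
  imports Defs "HOL-Library.Sublist"
begin

text \<open>
  The involution is the transposition of \<open>x\<^sub>0\<close> and \<open>x\<^sub>1\<close>. Let \<open>h\<close> be a homomorphism killing it. Conjugation
  shows that \<open>h\<close> kills all transpositions and takes the same value \<open>r\<close> on all transvections
  \<open>x\<^sub>j \<mapsto> x\<^sub>i x\<^sub>j\<close>; the relation between transvections on three indices reads \<open>r\<^sup>2 = r\<^sup>3\<close>, so they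
  are killed, and so are the inversions of generators, being products of these.

  It remains to see that Nielsen transformations generate the automorphism group. Among the
  automorphisms with a given image under \<open>h\<close> take one, \<open>g\<close>, that minimises the sum of
  \<open>code u + code u\<inverse>\<close> over \<open>u = g x\<^sub>i\<close>, where \<open>code\<close> reads a word as a numeral in base \<open>2n + 1\<close> (so that
  it refines the length). Transvections cannot lower this sum, hence the images of the generators
  are Nielsen reduced: \<open>g\<close> does not decrease lengths. Thus the inverse of \<open>g\<close> maps generators to
  letters, i.e. it is a signed permutation.
\<close>

section \<open>Cancellation in products of reduced words\<close>

definition winv :: "letter list \<Rightarrow> letter list" where
  "winv u = rev (map inv_letter u)"

lemma winv_simps [simp]:
  "winv [] = []" "winv [a] = [inv_letter a]" "winv (u @ v) = winv v @ winv u"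
  "winv (winv u) = u" "length (winv u) = length u" "winv u = [] \<longleftrightarrow> u = []"
  by (auto simp: winv_def rev_map comp_def)

lemma reduced_winv [simp]: "reduced (winv u) \<longleftrightarrow> reduced u"
  using reduced_inverse winv_simps(4) unfolding winv_def by metis

lemma nth_winv: "i < length u \<Longrightarrow> winv u ! i = inv_letter (u ! (length u - Suc i))"
  by (simp add: winv_def rev_nth)

lemma reduced_append:
  "reduced (u @ v) \<longleftrightarrow> reduced u \<and> reduced v \<and> (u = [] \<or> v = [] \<or> hd v \<noteq> inv_letter (last u))"
  by (auto simp: reduced_def successively_append_iff)

lemma reduced_nth:
  "reduced u \<Longrightarrow> Suc i < length u \<Longrightarrow> u ! Suc i \<noteq> inv_letter (u ! i)"
  by (simp add: reduced_def successively_conv_nth)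

lemma word_mult_append: "word_mult (u @ v) w = word_mult u (word_mult v w)"
  by (simp add: word_mult_def)

lemma word_mult_reduced: "reduced (u @ v) \<Longrightarrow> word_mult u v = u @ v"
  by (induction u) (auto simp: letter_mult_reduced reduced_Cons)

lemma word_mult_winv_append: "word_mult (winv p) (p @ r) = r"
proof (induction p)
  case (Cons a p)
  have "winv (a # p) = winv p @ [inv_letter a]" by (simp add: winv_def)
  with Cons show ?case by (simp add: word_mult_append letter_mult_def)
qed simp

lemma word_mult_cancel:
  "reduced (s @ r) \<Longrightarrow> word_mult (s @ winv p) (p @ r) = s @ r"
  by (simp add: word_mult_append word_mult_winv_append word_mult_reduced)

text \<open>The number of letters of \<open>v\<close> that disappear in the product of reduced
  \<open>u\<close> and \<open>v\<close>: they mirror an end of \<open>u\<close>, which is a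
  beginning of \<open>winv u\<close>.\<close>

definition cancellation :: "letter list \<Rightarrow> letter list \<Rightarrow> nat" where
  "cancellation u v = length (longest_common_prefix (winv u) v)"

lemma longest_common_prefix_maximal:
  "x = longest_common_prefix x y @ s \<Longrightarrow> y = longest_common_prefix x y @ r \<Longrightarrow>
   s = [] \<or> r = [] \<or> hd s \<noteq> hd r"
  by (induction x y arbitrary: s r rule: longest_common_prefix.induct) (auto split: if_splits)

text \<open>Maximality of the common prefix \<open>p\<close> makes the first letters of
  \<open>winv s\<close> and \<open>r\<close> differ, so nothing further cancels once
  \<open>p\<close> is removed.\<close>

lemma cancellation_split:
  assumes "reduced u" "reduced v"
  obtains s p r where "u = s @ winv p" "v = p @ r" "length p = cancellation u v" "reduced (s @ r)"
proof -
  let ?p = "longest_common_prefix (winv u) v"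
  obtain t r where t: "winv u = ?p @ t" and r: "v = ?p @ r"
    using longest_common_prefix_prefix1 longest_common_prefix_prefix2 unfolding prefix_def by blast
  have u: "u = winv t @ winv ?p" using t winv_simps(3,4) by metis
  have "t = [] \<or> r = [] \<or> hd t \<noteq> hd r"
    using longest_common_prefix_maximal t r by blast
  moreover have "inv_letter (last (winv t)) = hd t" if "t \<noteq> []"
    using that by (simp add: winv_def last_rev hd_map)
  moreover have "reduced (winv t)" "reduced r"
    using assms u r reduced_append by metis+
  ultimately have "reduced (winv t @ r)"
    unfolding reduced_append by (metis winv_simps(6))
  with u r show thesis using that cancellation_def by metis
qed

text \<open>Positions \<open>i\<close> and \<open>length u - 1 - i\<close> of \<open>u\<close> carry inverse letters throughout the
  cancelled part, which is impossible in the middle of \<open>u\<close>.\<close>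

lemma cancellation_square:
  assumes "reduced u" "u \<noteq> []"
  shows "2 * cancellation u u < length u"
proof (rule ccontr)
  assume long: "\<not> ?thesis"
  obtain s p r where u: "u = s @ winv p" "u = p @ r" and p: "length p = cancellation u u"
    using cancellation_split[OF assms(1) assms(1)] by metis
  have sym: "u ! i = inv_letter (u ! (length u - Suc i))" if "i < length p" for i
  proof -
    have "winv u = p @ winv s" using u(1) by simp
    then have "winv u ! i = u ! i" using u(2) that by (metis nth_append)
    moreover have "i < length u" using u(2) that by simp
    ultimately show ?thesis using nth_winv by metis
  qed
  show False
  proof (cases "even (length u)")
    case True
    then obtain m where m: "length u = 2 * m" by blast
    moreover from assms(2) have "length u > 0" by simp
    ultimately have "m - 1 < length p" "m > 0" using long p by linarith+
    from sym[OF this(1)] m this(2) have "u ! (m - 1) = inv_letter (u ! Suc (m - 1))" by simp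
    with reduced_nth[OF assms(1), of "m - 1"] m \<open>m > 0\<close> show False by simp
  next
    case False
    then obtain m where m: "length u = Suc (2 * m)" by (metis oddE Suc_eq_plus1)
    with long p have "m < length p" by auto
    from sym[OF this] m show False by (simp flip: mult_2)
  qed
qed

lemma not_reduced_append_winv: "p \<noteq> [] \<Longrightarrow> \<not> reduced (p @ winv p)"
  using cancellation_square[of "p @ winv p"]
  by (auto simp: reduced_append winv_def hd_rev last_map)

text \<open>Nielsen's argument: if the two neighbours of a factor never consume it entirely, every
  factor leaves at least one letter in the product.\<close>

lemma length_product_ge:
  fixes v :: "letter \<Rightarrow> letter list"
  assumes red: "\<And>a. a \<in> L \<Longrightarrow> reduced (v a)"
    and small: "\<And>a b d. \<lbrakk>a \<in> L; b \<in> L; d \<in> L; b \<noteq> inv_letter a; d \<noteq> inv_letter b\<rbrakk> \<Longrightarrow>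
       cancellation (v a) (v b) + cancellation (v b) (v d) < length (v b)"
    and w: "reduced w" "set w \<subseteq> L"
  shows "length (foldr (\<lambda>a. word_mult (v a)) w []) \<ge> length w"
proof -
  let ?P = "\<lambda>w. foldr (\<lambda>a. word_mult (v a)) w []"
  have nonempty: "v a \<noteq> []" if "a \<in> L" for a
    using small[OF that that that] by auto
  \<comment> \<open>Induction invariant: \<open>t\<close> is what the next factor leaves of
    \<open>v a\<close>, the lost end \<open>r\<close> has exactly the length of that cancellation,
    and \<open>z\<close> has at least one letter per remaining factor.\<close>
  have split: "\<exists>t z r. ?P (a # w) = t @ z \<and> v a = t @ r \<and> t \<noteq> [] \<and> length z \<ge> length w \<and>
      length r = (if w = [] then 0 else cancellation (v a) (v (hd w)))"
    if "reduced (a # w)" "set (a # w) \<subseteq> L" for a w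
    using that
  proof (induction w arbitrary: a)
    case Nil
    then show ?case using nonempty red by (auto simp: word_mult_Nil_right)
  next
    case (Cons b w)
    have L: "a \<in> L" "b \<in> L" and ab: "b \<noteq> inv_letter a" using Cons.prems by (auto simp: reduced_Cons)
    obtain t z r where t: "?P (b # w) = t @ z" "v b = t @ r" "t \<noteq> []" "length z \<ge> length w"
      and lr: "length r = (if w = [] then 0 else cancellation (v b) (v (hd w)))"
      using Cons.IH[of b] Cons.prems by (auto simp: reduced_Cons)
    obtain s p q where s: "v a = s @ winv p" "v b = p @ q"
      and p: "length p = cancellation (v a) (v b)" and sq: "reduced (s @ q)"
      using cancellation_split red L by metis
    have "length p + length r < length (v b)"
    proof (cases "w = []")
      case True
      \<comment> \<open>The last factor has no right neighbour; \<open>small\<close> is applied with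
        \<open>d = b\<close>, since no letter is its own inverse.\<close>
      then show ?thesis using small[OF L(1,2,2) ab] lr p by auto
    next
      case False
      then have "hd w \<in> L" "hd w \<noteq> inv_letter b" using Cons.prems by (auto simp: reduced_Cons)
      then show ?thesis using small[OF L _ ab] lr p False by auto
    qed
    \<comment> \<open>The beginning of \<open>v b\<close> cancelled by \<open>v a\<close> stops
      before the end cancelled from the right starts, so a nonempty middle \<open>t'\<close>
      survives.\<close>
    then have "length p < length t" using t(2) by simp
    then obtain t' where t': "t = p @ t'" "t' \<noteq> []"
      using s(2) t(2) by (auto simp: append_eq_append_conv2)
    have "?P (a # b # w) = word_mult (s @ winv p) (p @ t' @ z)"
      using t(1) t'(1) s(1) by simp
    also have "\<dots> = s @ t' @ z"
    proof (rule word_mult_cancel)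
      have "reduced (?P (b # w))"
      proof -
        have "reduced (?P w)" if "set w \<subseteq> L" for w
          using that by (induction w) (auto simp: reduced_word_mult)
        then show ?thesis using Cons.prems by (simp add: reduced_word_mult)
      qed
      then have "reduced (t' @ z)" using t(1) t'(1) by (simp add: reduced_append)
      moreover have "reduced (s @ t')"
      proof -
        have "q = t' @ r" using s(2) t(2) t'(1) by simp
        with sq have "reduced ((s @ t') @ r)" by simp
        then show ?thesis unfolding reduced_append[of "s @ t'"] by blast
      qed
      \<comment> \<open>Two reduced words overlapping in the nonempty \<open>t'\<close> glue to a
        reduced word.\<close>
      ultimately show "reduced (s @ t' @ z)"
        using t'(2) by (auto simp: reduced_append)
    qed
    finally have "?P (a # b # w) = s @ (t' @ z)" by simp
    moreover have "s \<noteq> []"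
    proof
      assume "s = []"
      then have "length (v a) = cancellation (v a) (v b)" using s(1) p by simp
      then show False using small[OF L(1) L ] ab by auto
    qed
    moreover have "length (t' @ z) \<ge> length (b # w)" using t(4) t'(2) by (cases t') auto
    ultimately show ?case
      using s(1) p by (intro exI[of _ s] exI[of _ "t' @ z"] exI[of _ "winv p"]) simp
  qed
  then show ?thesis
  proof (cases w)
    case (Cons a w')
    then obtain t z where "?P w = t @ z" "t \<noteq> []" "length z \<ge> length w'"
      using split[of a w'] w by blast
    then show ?thesis using Cons by (cases t) auto
  qed simp
qed

section \<open>Words of minimal weight\<close>

text \<open>For indices below \<open>n\<close> the digits run from 1 to \<open>2 * n\<close>. No
  letter has digit 0, so longer words get larger codes, and words of equal length are compared
  lexicographically.\<close>

primrec code :: "nat \<Rightarrow> letter list \<Rightarrow> nat" where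
  "code n [] = 0"
| "code n (a # w) = (2 * fst a + (if snd a then 1 else 2)) * (2 * n + 1) ^ length w + code n w"

lemma code_append: "code n (u @ v) = code n u * (2 * n + 1) ^ length v + code n v"
  by (induction u) (auto simp: power_add algebra_simps)

lemma code_less: "(\<forall>a\<in>set u. fst a < n) \<Longrightarrow> code n u < (2 * n + 1) ^ length u"
proof (induction u)
  case (Cons a u)
  let ?d = "2 * fst a + (if snd a then 1 else 2)"
  have "(?d + 1) * (2 * n + 1) ^ length u \<le> (2 * n + 1) * (2 * n + 1) ^ length u"
    using Cons.prems by (intro mult_right_mono) auto
  with Cons show ?case by (simp add: algebra_simps)
qed simp

lemma code_ge: "(2 * n + 1) ^ length u \<le> code n (a # u)"
proof -
  have "1 * (2 * n + 1) ^ length u \<le> (2 * fst a + (if snd a then 1 else 2)) * (2 * n + 1) ^ length u"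
    by (intro mult_right_mono) auto
  then show ?thesis by simp
qed

lemma code_less_length:
  assumes "\<forall>a\<in>set u. fst a < n" "length u < length v"
  shows "code n u < code n v"
proof -
  obtain a v' where v: "v = a # v'" using assms(2) by (cases v) auto
  have "code n u < (2 * n + 1) ^ length u" by (rule code_less) fact
  also have "\<dots> \<le> (2 * n + 1) ^ length v'" using assms(2) v by (intro power_increasing) auto
  also have "\<dots> \<le> code n v" unfolding v by (rule code_ge)
  finally show ?thesis .
qed

lemma code_inject:
  assumes "length u = length v" "\<forall>a\<in>set u. fst a < n" "\<forall>a\<in>set v. fst a < n" "code n u = code n v"
  shows "u = v"
  using assms
proof (induction u v rule: list_induct2)
  case (Cons a u b v)
  let ?B = "(2 * n + 1) ^ length u" and ?d = "\<lambda>a :: letter. 2 * fst a + (if snd a then 1 else 2)"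
  have less: "code n u < ?B" "code n v < ?B" using code_less[of u n] code_less[of v n] Cons by auto
  have eq: "?d a * ?B + code n u = ?d b * ?B + code n v" using Cons by simp
  \<comment> \<open>The tails stay below \<open>?B\<close>, so division reads off the leading digit,
    whose parity then gives the sign of the letter.\<close>
  from arg_cong[OF eq, of "\<lambda>x. x div ?B"] have "?d a = ?d b" using less by simp
  then have "a = b" by (auto simp: prod_eq_iff split: if_splits) presburger+
  with eq Cons show ?case by simp
qed simp

text \<open>Symmetric under inversion, so that a bound on left multiplication also controls right
  multiplication.\<close>

definition weight :: "nat \<Rightarrow> letter list \<Rightarrow> nat" where
  "weight n u = code n u + code n (winv u)"

lemma weight_winv [simp]: "weight n (winv u) = weight n u"
  by (simp add: weight_def)

lemma letters_winv: "(\<forall>a\<in>set (winv u). fst a < n) \<longleftrightarrow> (\<forall>a\<in>set u. fst a < n)"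
  by (auto simp: winv_def)

lemma weight_less_length:
  assumes "\<forall>a\<in>set u. fst a < n" "length u < length v"
  shows "weight n u < weight n v"
  using code_less_length[of u n v] code_less_length[of "winv u" n "winv v"] assms letters_winv
  by (simp add: weight_def)

text \<open>If two words differ only in initial segments \<open>p\<close>, \<open>q\<close> of equal length, at most half of the
  total length, then the code of the inverse words cannot offset the difference of the codes.\<close>

lemma weight_prefix_le:
  assumes le: "weight n (q @ r) \<le> weight n (p @ r)"
    and len: "length p = length q" "length q \<le> length r"
    and p: "\<forall>a\<in>set p. fst a < n"
  shows "code n q \<le> code n p"
proof (rule ccontr)
  assume "\<not> ?thesis"
  \<comment> \<open>An increase in the leading segment costs at least the place value given by
    \<open>r\<close>, which the final segment \<open>winv p\<close> of the inverse word cannot make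
    up.\<close>
  then have "(code n p + 1) * (2 * n + 1) ^ length r \<le> code n q * (2 * n + 1) ^ length r"
    by (intro mult_right_mono) auto
  moreover have "code n (winv p) < (2 * n + 1) ^ length p"
    using code_less[of "winv p" n] letters_winv p by simp
  moreover have "(2 * n + 1) ^ length p \<le> (2 * n + 1) ^ length r"
    using len by (intro power_increasing) auto
  ultimately show False using le len by (simp add: weight_def code_append algebra_simps)
qed

text \<open>When both half cancellations occur, \<open>v b = p @ winv q\<close>, and minimality of
  \<open>v d\<close> and of \<open>v (inv_letter a)\<close> compares \<open>p\<close> and \<open>q\<close> in both directions.\<close>

lemma minimal_small_cancellation:
  fixes n :: nat and v :: "letter \<Rightarrow> letter list"
  defines "L \<equiv> {a. fst a < n}"
  assumes red: "\<And>a. a \<in> L \<Longrightarrow> reduced (v a)"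
    and letters: "\<And>a x. a \<in> L \<Longrightarrow> x \<in> set (v a) \<Longrightarrow> fst x < n"
    and nonempty: "\<And>a. a \<in> L \<Longrightarrow> v a \<noteq> []"
    and inv: "\<And>a. a \<in> L \<Longrightarrow> v (inv_letter a) = winv (v a)"
    and minimal: "\<And>a b. \<lbrakk>a \<in> L; b \<in> L; fst a \<noteq> fst b\<rbrakk> \<Longrightarrow>
      weight n (v b) \<le> weight n (word_mult (v a) (v b))"
    and L: "a \<in> L" "b \<in> L" "d \<in> L" and ab: "b \<noteq> inv_letter a" and bd: "d \<noteq> inv_letter b"
  shows "cancellation (v a) (v b) + cancellation (v b) (v d) < length (v b)"
proof -
  have inv_L: "inv_letter a \<in> L" if "a \<in> L" for a using that by (simp add: L_def)
  have same: "a = b" if "b \<noteq> inv_letter a" "fst a = fst b" for a b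
    using that by (cases a; cases b) (auto simp: inv_letter_def)
  have letters_mult: "\<forall>x\<in>set (word_mult (v a) (v b)). fst x < n" if "a \<in> L" "b \<in> L" for a b
    using set_word_mult[of "v a" "v b"] letters that by blast
  \<comment> \<open>Minimality forbids the product to be shorter than either factor, so at most half
    of each is cancelled.\<close>
  have half: "2 * cancellation (v a) (v b) \<le> length (v a) \<and> 2 * cancellation (v a) (v b) \<le> length (v b)"
    if L: "a \<in> L" "b \<in> L" and ne: "fst a \<noteq> fst b" for a b
  proof -
    obtain s p r where s: "v a = s @ winv p" "v b = p @ r"
      and p: "length p = cancellation (v a) (v b)" and sr: "reduced (s @ r)"
      using cancellation_split red L by metis
    have prod: "word_mult (v a) (v b) = s @ r" using s sr word_mult_cancel by simp
    \<comment> \<open>Minimality only speaks of left multiplication; the comparison with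
      \<open>v a\<close> comes from the inverse product.\<close>
    have prod': "word_mult (v (inv_letter b)) (v (inv_letter a)) = winv (s @ r)"
      using inv[OF L(1)] inv[OF L(2)] s word_mult_cancel[of "winv r" "winv s" p] sr
        reduced_winv[of "s @ r"] by simp
    have "length (v b) \<le> length (s @ r)"
      using minimal[OF L ne] weight_less_length[OF letters_mult[OF L]] prod
      by (metis linorder_not_less)
    moreover have "length (v a) \<le> length (s @ r)"
      using minimal[OF inv_L[OF L(2)] inv_L[OF L(1)]] ne inv[OF L(1)] prod'
        weight_less_length[OF letters_mult[OF L]] prod
      by (metis fst_inv_letter linorder_not_less weight_winv)
    ultimately show ?thesis using s p by auto
  qed
  \<comment> \<open>Equal indices leave only \<open>a = b\<close>, where the cancellation in a
    square is even strictly below half.\<close>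
  have weak: "2 * cancellation (v a) (v b) \<le> length (v b) \<and> 2 * cancellation (v a) (v b) \<le> length (v a)"
    if "a \<in> L" "b \<in> L" "b \<noteq> inv_letter a" for a b
    using half[OF that(1,2)] same[OF that(3)] cancellation_square[of "v a"] red nonempty that
    by (cases "fst a = fst b") auto
  show ?thesis
  proof (rule ccontr)
    assume neg: "\<not> ?thesis"
    from weak[OF L(1,2) ab] weak[OF L(2,3) bd] neg
    have eq: "2 * cancellation (v a) (v b) = length (v b)" "2 * cancellation (v b) (v d) = length (v b)"
      by auto
    have ne: "fst a \<noteq> fst b" "fst b \<noteq> fst d"
      using same[OF ab] same[OF bd] eq cancellation_square[of "v b"] red nonempty L by auto
    obtain s p r where s: "v a = s @ winv p" "v b = p @ r"
      and p: "length p = cancellation (v a) (v b)" and sr: "reduced (s @ r)"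
      using cancellation_split red L by metis
    obtain s' q t where s': "v b = s' @ winv q" "v d = q @ t"
      and q: "length q = cancellation (v b) (v d)" and st: "reduced (s' @ t)"
      using cancellation_split red L by metis
    have len: "length p = length q" "length s' = length q" using p q eq s' by auto
    then have "s' = p" "r = winv q" using s(2) s'(1) by auto
    note s = s[unfolded this] and sr = sr[unfolded this] and st = st[unfolded this]
    have long: "length q \<le> length t" "length p \<le> length s"
      using half[OF L(2,3) ne(2)] half[OF L(1,2) ne(1)] s s' p q by auto
    have letters_p: "\<forall>x\<in>set p. fst x < n" and letters_q: "\<forall>x\<in>set q. fst x < n"
      using letters[OF L(2)] letters[OF L(3)] s s' by auto
    \<comment> \<open>Multiplying \<open>v d = q @ t\<close> by \<open>v b\<close> replaces
      \<open>q\<close> by \<open>p\<close>; below, multiplying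
      \<open>v (inv_letter a) = p @ winv s\<close> by \<open>v (inv_letter b)\<close> replaces
      \<open>p\<close> by \<open>q\<close>.\<close>
    have "code n q \<le> code n p"
      using minimal[OF L(2,3) ne(2)] s s' word_mult_cancel[OF st] len long letters_p
      by (intro weight_prefix_le[of n q t p]) auto
    moreover have "code n p \<le> code n q"
    proof (rule weight_prefix_le[of n p "winv s" q])
      have "word_mult (v (inv_letter b)) (v (inv_letter a)) = q @ winv s"
        using inv[OF L(1)] inv[OF L(2)] s word_mult_cancel[of q "winv s" p] sr
          reduced_winv[of "s @ winv q"] by simp
      then show "weight n (p @ winv s) \<le> weight n (q @ winv s)"
        using minimal[OF inv_L[OF L(2)] inv_L[OF L(1)]] ne(1) inv[OF L(1)] s(1) by simp
    qed (use len long letters_q in auto)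
    \<comment> \<open>Then \<open>v b = p @ winv p\<close>, which is not reduced.\<close>
    ultimately have "p = q" using code_inject len letters_p letters_q by simp
    with s(2) red[OF L(2)] nonempty[OF L(2)] not_reduced_append_winv show False by fastforce
  qed
qed

section \<open>Automorphisms of the free group\<close>

lemma inv_letter_fst_neq [simp]:
  "fst a \<noteq> fst b \<Longrightarrow> a \<noteq> b" "fst a \<noteq> fst b \<Longrightarrow> a \<noteq> inv_letter b"
  "fst a \<noteq> fst b \<Longrightarrow> inv_letter a \<noteq> b"
  by auto

lemma fst_eq_letter: "fst a = fst b \<longleftrightarrow> a = b \<or> a = inv_letter b"
  by (cases a; cases b) (auto simp: inv_letter_def)

context
  fixes n :: nat
begin

private abbreviation (input) F where "F \<equiv> free_group n"
private abbreviation (input) A where "A \<equiv> Aut_free_group n"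

interpretation F: group "free_group n" by (rule group_free_group)
interpretation A: group "Aut_free_group n" by (rule group_Aut_free_group)

section \<open>Homomorphisms of the free group as products over letters\<close>

lemma carrier_free_group: "w \<in> carrier F \<longleftrightarrow> reduced w \<and> (\<forall>a\<in>set w. fst a < n)"
  by (simp add: free_group_def)

lemma mult_free_group: "u \<otimes>\<^bsub>F\<^esub> v = word_mult u v"
  by (simp add: free_group_def)

lemma one_free_group: "\<one>\<^bsub>F\<^esub> = []"
  by (simp add: free_group_def)

lemma letter_in_free_group: "[a] \<in> carrier F \<longleftrightarrow> fst a < n"
  by (simp add: carrier_free_group reduced_Cons)

lemma inv_free_group: "u \<in> carrier F \<Longrightarrow> inv\<^bsub>F\<^esub> u = winv u"
  by (rule F.inv_equality)
    (auto simp: free_group_def winv_def word_mult_left_inverse reduced_inverse)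

lemma hom_Nil: "f \<in> hom F F \<Longrightarrow> f [] = []"
  using group_hom.hom_one[of F F f]
  by (simp add: group_hom_def group_hom_axioms_def group_free_group one_free_group)

lemma hom_winv: "f \<in> hom F F \<Longrightarrow> u \<in> carrier F \<Longrightarrow> f (winv u) = winv (f u)"
  using group_hom.hom_inv[of F F f u] inv_free_group[of u] inv_free_group[of "f u"]
  by (simp add: group_hom_def group_hom_axioms_def group_free_group hom_in_carrier)

lemma hom_inv_letter: "f \<in> hom F F \<Longrightarrow> fst a < n \<Longrightarrow> f [inv_letter a] = winv (f [a])"
  using hom_winv[of f "[a]"] letter_in_free_group by simp

lemma hom_Cons:
  assumes "f \<in> hom F F" "a # w \<in> carrier F"
  shows "f (a # w) = word_mult (f [a]) (f w)"
proof -
  have "[a] \<in> carrier F" "w \<in> carrier F" "[a] \<otimes>\<^bsub>F\<^esub> w = a # w"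
    using assms(2) by (auto simp: carrier_free_group reduced_Cons mult_free_group letter_mult_reduced)
  then show ?thesis using hom_mult[OF assms(1)] mult_free_group by metis
qed

lemma hom_foldr:
  "f \<in> hom F F \<Longrightarrow> w \<in> carrier F \<Longrightarrow> f w = foldr (\<lambda>a. word_mult (f [a])) w []"
proof (induction w)
  case Nil
  then show ?case by (simp add: hom_Nil)
next
  case (Cons a w)
  then show ?case using hom_Cons[of f a w] by (simp add: carrier_free_group reduced_Cons)
qed

section \<open>The automorphism group\<close>

lemma carrier_Aut:
  "f \<in> carrier A \<longleftrightarrow> f \<in> hom F F \<and> f \<in> extensional (carrier F) \<and> bij_betw f (carrier F) (carrier F)"
  by (auto simp: Aut_free_group_def AutoGroup_def auto_def Bij_def)

lemma Aut_hom: "f \<in> carrier A \<Longrightarrow> f \<in> hom F F"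
  by (simp add: carrier_Aut)

lemma Aut_closed: "f \<in> carrier A \<Longrightarrow> w \<in> carrier F \<Longrightarrow> f w \<in> carrier F"
  by (meson Aut_hom hom_in_carrier)

lemma Aut_mult: "f \<in> carrier A \<Longrightarrow> g \<in> carrier A \<Longrightarrow> w \<in> carrier F \<Longrightarrow> (f \<otimes>\<^bsub>A\<^esub> g) w = f (g w)"
  by (simp add: Aut_free_group_def AutoGroup_def auto_def BijGroup_def compose_def)

lemma Aut_one: "w \<in> carrier F \<Longrightarrow> \<one>\<^bsub>A\<^esub> w = w"
  by (simp add: Aut_free_group_def AutoGroup_def BijGroup_def)

text \<open>One letter of each index suffices, because homomorphisms respect inversion. Which of the
  two is left open, since transvections are most easily evaluated at the letter that they
  multiply.\<close>

lemma Aut_eqI: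
  assumes "f \<in> carrier A" "g \<in> carrier A"
    and eq: "\<And>i. i < n \<Longrightarrow> \<exists>a. fst a = i \<and> f [a] = g [a]"
  shows "f = g"
proof (rule extensionalityI)
  have letter: "f [b] = g [b]" if "fst b < n" for b
  proof -
    obtain a where a: "fst a = fst b" "f [a] = g [a]" using eq \<open>fst b < n\<close> by blast
    then have "b = a \<or> b = inv_letter a" by (simp add: fst_eq_letter[symmetric])
    then show ?thesis using a hom_inv_letter Aut_hom assms(1,2) \<open>fst b < n\<close> by metis
  qed
  fix w assume "w \<in> carrier F"
  moreover from this have "foldr (\<lambda>a. word_mult (f [a])) w [] = foldr (\<lambda>a. word_mult (g [a])) w []"
    by (intro foldr_cong) (simp_all add: letter carrier_free_group)
  ultimately show "f w = g w"
    using hom_foldr Aut_hom assms(1,2) by simp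
qed (use assms carrier_Aut in auto)

section \<open>Endomorphisms prescribed on letters\<close>

definition endo :: "(letter \<Rightarrow> letter list) \<Rightarrow> letter list \<Rightarrow> letter list" where
  "endo v = (\<lambda>w\<in>carrier F. foldr (\<lambda>a. word_mult (v a)) w [])"

lemma endo_letter: "fst a < n \<Longrightarrow> reduced (v a) \<Longrightarrow> endo v [a] = v a"
  by (simp add: endo_def letter_in_free_group word_mult_Nil_right)

text \<open>The second assumption makes the values on negative letters agree with those forced by
  the positive ones; the homomorphism from the universal property then coincides with
  \<open>endo v\<close>.\<close>

lemma endo_hom:
  assumes "\<And>a. fst a < n \<Longrightarrow> v a \<in> carrier F" "\<And>a. fst a < n \<Longrightarrow> v (inv_letter a) = winv (v a)"
  shows "endo v \<in> hom F F"
proof -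
  obtain h where h: "h \<in> hom F F" and gen: "\<And>i. i < n \<Longrightarrow> h [(i, True)] = v (i, True)"
    using free_group_universal[OF group_free_group, where n = n and f = "\<lambda>i. v (i, True)"] assms(1)
    by (metis fst_conv)
  have letter: "h [a] = v a" if "fst a < n" for a
  proof -
    have "a = (fst a, True) \<or> a = inv_letter (fst a, True)"
      by (cases a) (auto simp: inv_letter_def)
    then show ?thesis
      using gen[OF that] hom_inv_letter[OF h, of "(fst a, True)"] assms(2)[of "(fst a, True)"] that
      by (metis fst_conv)
  qed
  have "endo v w = h w" if "w \<in> carrier F" for w
    unfolding hom_foldr[OF h that] using that
    by (simp add: endo_def) (intro foldr_cong, simp_all add: letter carrier_free_group)
  then show ?thesis using h by (auto simp: hom_def)
qed

text \<open>Both compositions fix every letter, hence every word, so \<open>endo v\<close> is a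
  two-sided inverse of \<open>endo u\<close>.\<close>

lemma endo_Aut:
  assumes "\<And>a. fst a < n \<Longrightarrow> u a \<in> carrier F" "\<And>a. fst a < n \<Longrightarrow> u (inv_letter a) = winv (u a)"
    and "\<And>a. fst a < n \<Longrightarrow> v a \<in> carrier F" "\<And>a. fst a < n \<Longrightarrow> v (inv_letter a) = winv (v a)"
    and uv: "\<And>a. fst a < n \<Longrightarrow> endo u (v a) = [a]" and vu: "\<And>a. fst a < n \<Longrightarrow> endo v (u a) = [a]"
  shows "endo u \<in> carrier A"
proof -
  have inverse: "endo u (endo v w) = w"
    if u: "endo u \<in> hom F F" and v: "endo v \<in> hom F F" and red: "\<And>a. fst a < n \<Longrightarrow> reduced (v a)"
      and uv: "\<And>a. fst a < n \<Longrightarrow> endo u (v a) = [a]"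
      and w: "w \<in> carrier F" for u v w
  proof -
    have "endo u \<circ> endo v \<in> hom F F" using Group.hom_compose[OF v u] .
    moreover have "(endo u \<circ> endo v) [a] = [a]" if "fst a < n" for a
      using that uv red endo_letter by simp
    moreover have "foldr (\<lambda>a. word_mult ((endo u \<circ> endo v) [a])) w [] = foldr (\<lambda>a. word_mult [a]) w []"
      by (rule foldr_cong) (use calculation(2) w in \<open>auto simp: carrier_free_group\<close>)
    moreover have "foldr (\<lambda>a. word_mult [a]) w [] = word_mult w []"
      by (induction w) simp_all
    ultimately show ?thesis
      using hom_foldr[of "endo u \<circ> endo v" w] w by (simp add: carrier_free_group word_mult_Nil_right)
  qed
  have hom: "endo u \<in> hom F F" "endo v \<in> hom F F"
    by (rule endo_hom; simp add: assms(1-4))+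
  have red: "reduced (u a)" "reduced (v a)" if "fst a < n" for a
    using assms(1)[OF that] assms(3)[OF that] by (simp_all add: carrier_free_group)
  have "bij_betw (endo u) (carrier F) (carrier F)"
  proof (rule bij_betwI[where g = "endo v"])
    show "endo u \<in> carrier F \<rightarrow> carrier F" "endo v \<in> carrier F \<rightarrow> carrier F"
      using hom by (auto simp: hom_def)
    show "endo v (endo u w) = w" if "w \<in> carrier F" for w
      using inverse[OF hom(2,1) red(1) vu that] .
    show "endo u (endo v w) = w" if "w \<in> carrier F" for w
      using inverse[OF hom red(2) uv that] .
  qed
  then show ?thesis using hom(1) by (simp add: carrier_Aut endo_def)
qed

text \<open>The transvection with \<open>b \<mapsto> a b\<close> for letters \<open>a\<close>, \<open>b\<close>; with \<open>b = (i, False)\<close> it multiplies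
  \<open>x\<^sub>i\<close> on the right by the inverse of \<open>a\<close>.\<close>

definition transv :: "letter \<Rightarrow> letter \<Rightarrow> letter list \<Rightarrow> letter list" where
  "transv a b = endo (\<lambda>d. if d = b then [a, b]
     else if d = inv_letter b then [inv_letter b, inv_letter a] else [d])"

text \<open>The inverse of the transvection has \<open>inv_letter a\<close> in place of
  \<open>a\<close>; the auxiliary facts are therefore kept general in \<open>a\<close>.\<close>

lemma
  assumes "fst a < n" "fst b < n" "fst a \<noteq> fst b"
  shows transv_Aut: "transv a b \<in> carrier A"
    and transv_same: "transv a b [b] = [a, b]"
    and transv_other: "fst d < n \<Longrightarrow> fst d \<noteq> fst b \<Longrightarrow> transv a b [d] = [d]"
proof -
  let ?v = "\<lambda>a d. if d = b then [a, b]
    else if d = inv_letter b then [inv_letter b, inv_letter a] else [d]"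
  have v: "?v a d \<in> carrier F" "?v a (inv_letter d) = winv (?v a d)"
    if "fst a < n" "fst a \<noteq> fst b" "fst d < n" for a d
  proof -
    consider "d = b" | "d = inv_letter b" | "d \<noteq> b" "d \<noteq> inv_letter b" "inv_letter d \<noteq> b"
      by (metis inv_letter_invol)
    then have "?v a d \<in> carrier F \<and> ?v a (inv_letter d) = winv (?v a d)"
      by cases
        (use that assms(2) that(2)[symmetric] in \<open>simp_all add: carrier_free_group reduced_Cons winv_def\<close>)
    then show "?v a d \<in> carrier F" "?v a (inv_letter d) = winv (?v a d)" by blast+
  qed
  have letter: "endo (?v a) [d] = ?v a d" if "fst a < n" "fst a \<noteq> fst b" "fst d < n" for a d
    using endo_letter[of d "?v a"] v[OF that] that(3) carrier_free_group by blast
  have hom: "endo (?v a) \<in> hom F F" if "fst a < n" "fst a \<noteq> fst b" for a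
    by (rule endo_hom) (use v that in blast)+
  have inverse: "endo (?v a) (?v (inv_letter a) d) = [d]"
    if a: "fst a < n" "fst a \<noteq> fst b" and d: "fst d < n" for a d
  proof -
    have mem: "[inv_letter a, b] \<in> carrier F" "[inv_letter b, a] \<in> carrier F"
      using a a(2)[symmetric] assms(2) by (simp_all add: carrier_free_group reduced_Cons)
    have "endo (?v a) [inv_letter a, b] = [b]" "endo (?v a) [inv_letter b, a] = [inv_letter b]"
      using hom_Cons[OF hom[OF a] mem(1)] hom_Cons[OF hom[OF a] mem(2)] letter[OF a] a a(2)[symmetric] assms(2)
      by (simp_all add: letter_mult_def)
    then show ?thesis using letter[OF a d] by auto
  qed
  show "transv a b \<in> carrier A"
    unfolding transv_def
  proof (rule endo_Aut[where v = "?v (inv_letter a)"])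
    show "endo (?v (inv_letter a)) (?v a d) = [d]" if "fst d < n" for d
      unfolding inv_letter_invol
      by (rule inverse[of "inv_letter a" d, unfolded inv_letter_invol fst_inv_letter, OF assms(1,3) that])
  qed (use v[of a] v[of "inv_letter a"] inverse[of a] assms in simp_all)
  show "transv a b [b] = [a, b]" using letter[of a b] assms by (simp add: transv_def)
  show "transv a b [d] = [d]" if "fst d < n" "fst d \<noteq> fst b"
    using letter[of a d] assms that by (simp add: transv_def)
qed

text \<open>One notion for both transpositions and inversions of generators; the relabelling induced
  by an involution is its own inverse.\<close>

definition letter_involution :: "(letter \<Rightarrow> letter) \<Rightarrow> bool" where
  "letter_involution \<sigma> \<longleftrightarrow>
     (\<forall>a. \<sigma> (\<sigma> a) = a \<and> \<sigma> (inv_letter a) = inv_letter (\<sigma> a) \<and> (fst a < n \<longrightarrow> fst (\<sigma> a) < n))"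

lemma letter_involution_less: "letter_involution \<sigma> \<Longrightarrow> fst a < n \<Longrightarrow> fst (\<sigma> a) < n"
  by (simp only: letter_involution_def)

definition relabel :: "(letter \<Rightarrow> letter) \<Rightarrow> letter list \<Rightarrow> letter list" where
  "relabel \<sigma> = endo (\<lambda>a. [\<sigma> a])"

lemma relabel_letter: "fst a < n \<Longrightarrow> relabel \<sigma> [a] = [\<sigma> a]"
  by (simp add: relabel_def endo_letter reduced_Cons)

lemma relabel_Aut: "letter_involution \<sigma> \<Longrightarrow> relabel \<sigma> \<in> carrier A"
  unfolding relabel_def
  by (rule endo_Aut[where v = "\<lambda>a. [\<sigma> a]"])
    (auto simp: letter_involution_def letter_in_free_group endo_letter reduced_Cons)

lemma relabel_fst_neq:
  "letter_involution \<sigma> \<Longrightarrow> fst a \<noteq> fst b \<Longrightarrow> fst (\<sigma> a) \<noteq> fst (\<sigma> b)"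
  unfolding fst_eq_letter letter_involution_def by metis

lemma Aut_Cons:
  "f \<in> carrier A \<Longrightarrow> a # b # w \<in> carrier F \<Longrightarrow> f (a # b # w) = word_mult (f [a]) (f (b # w))"
  using hom_Cons Aut_hom by blast

text \<open>Conjugation by a relabelling renames both letters of a transvection; here it is written
  as an equation of products.\<close>

lemma relabel_transv:
  assumes \<sigma>: "letter_involution \<sigma>" and ab: "fst a < n" "fst b < n" "fst a \<noteq> fst b"
  shows "relabel \<sigma> \<otimes>\<^bsub>A\<^esub> transv a b = transv (\<sigma> a) (\<sigma> b) \<otimes>\<^bsub>A\<^esub> relabel \<sigma>"
proof (rule Aut_eqI)
  have \<sigma>ab: "fst (\<sigma> a) < n" "fst (\<sigma> b) < n" "fst (\<sigma> a) \<noteq> fst (\<sigma> b)"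
    using relabel_fst_neq[OF \<sigma>] ab by (simp_all add: letter_involution_less[OF \<sigma>])
  note aut = relabel_Aut[OF \<sigma>] transv_Aut[OF ab] transv_Aut[OF \<sigma>ab]
  show "relabel \<sigma> \<otimes>\<^bsub>A\<^esub> transv a b \<in> carrier A" "transv (\<sigma> a) (\<sigma> b) \<otimes>\<^bsub>A\<^esub> relabel \<sigma> \<in> carrier A"
    using aut by simp_all
  fix i assume i: "i < n"
  define d where "d = (if i = fst b then b else (i, True))"
  have d: "fst d = i" by (simp add: d_def)
  have "(relabel \<sigma> \<otimes>\<^bsub>A\<^esub> transv a b) [d] = (transv (\<sigma> a) (\<sigma> b) \<otimes>\<^bsub>A\<^esub> relabel \<sigma>) [d]"
  proof (cases "i = fst b")
    case True
    have ab': "[a, b] \<in> carrier F"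
      using ab ab(3)[symmetric] by (simp add: carrier_free_group reduced_Cons)
    have "relabel \<sigma> [a, b] = [\<sigma> a, \<sigma> b]"
      unfolding Aut_Cons[OF aut(1) ab']
      using ab \<sigma>ab \<sigma>ab(3)[symmetric] by (simp add: relabel_letter letter_mult_def)
    then show ?thesis
      using True ab \<sigma>ab aut
      by (simp add: d_def Aut_mult letter_in_free_group transv_same relabel_letter)
  next
    case False
    then have "fst (\<sigma> d) \<noteq> fst (\<sigma> b)" using relabel_fst_neq[OF \<sigma>] d by simp
    moreover have "fst (\<sigma> d) < n" using d i by (simp add: letter_involution_less[OF \<sigma>])
    ultimately show ?thesis
      using False d i ab \<sigma>ab aut
      by (simp add: Aut_mult letter_in_free_group transv_other relabel_letter)
  qed
  with d show "\<exists>d. fst d = i \<and> (relabel \<sigma> \<otimes>\<^bsub>A\<^esub> transv a b) [d] = (transv (\<sigma> a) (\<sigma> b) \<otimes>\<^bsub>A\<^esub> relabel \<sigma>) [d]"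
    by blast
qed

text \<open>A form of the Steinberg commutator relation: both sides send \<open>b\<close> to
  \<open>a b\<close> and \<open>c\<close> to \<open>a b c\<close>.\<close>

lemma transv_relation:
  assumes n: "fst a < n" "fst b < n" "fst c < n"
    and ne: "fst a \<noteq> fst b" "fst a \<noteq> fst c" "fst b \<noteq> fst c"
  shows "transv a b \<otimes>\<^bsub>A\<^esub> transv b c = transv b c \<otimes>\<^bsub>A\<^esub> (transv a b \<otimes>\<^bsub>A\<^esub> transv a c)"
proof (rule Aut_eqI)
  have aut: "transv a b \<in> carrier A" "transv b c \<in> carrier A" "transv a c \<in> carrier A"
    using transv_Aut n ne by simp_all
  then show "transv a b \<otimes>\<^bsub>A\<^esub> transv b c \<in> carrier A"
    "transv b c \<otimes>\<^bsub>A\<^esub> (transv a b \<otimes>\<^bsub>A\<^esub> transv a c) \<in> carrier A"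
    by simp_all
  fix i assume i: "i < n"
  define d where "d = (if i = fst b then b else if i = fst c then c else (i, True))"
  have d: "fst d = i" by (simp add: d_def)
  have "[b, c] \<in> carrier F" "[a, c] \<in> carrier F" "[a, b] \<in> carrier F"
    using n ne by (auto simp: carrier_free_group reduced_Cons)
  note split = Aut_Cons[OF aut(1) this(1)] Aut_Cons[OF aut(1) this(2)] Aut_Cons[OF aut(2) this(2)]
    Aut_Cons[OF aut(2) this(3)]
  note eval = Aut_mult transv_same transv_other letter_in_free_group letter_mult_def
  consider "d = b" | "d = c" | "fst d \<noteq> fst b" "fst d \<noteq> fst c"
    using d by (cases "i = fst b"; cases "i = fst c") (simp_all add: d_def)
  then have "(transv a b \<otimes>\<^bsub>A\<^esub> transv b c) [d] = (transv b c \<otimes>\<^bsub>A\<^esub> (transv a b \<otimes>\<^bsub>A\<^esub> transv a c)) [d]"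
  proof cases
    case 1
    then show ?thesis using n ne ne[symmetric] aut split by (simp add: eval)
  next
    case 2
    then show ?thesis using n ne ne[symmetric] aut split by (simp add: eval)
  next
    case 3
    then show ?thesis using n ne aut d i by (simp add: eval)
  qed
  with d show "\<exists>d. fst d = i \<and> (transv a b \<otimes>\<^bsub>A\<^esub> transv b c) [d] =
      (transv b c \<otimes>\<^bsub>A\<^esub> (transv a b \<otimes>\<^bsub>A\<^esub> transv a c)) [d]"
    by blast
qed

section \<open>Transpositions and inversions of generators\<close>

definition swap :: "nat \<Rightarrow> nat \<Rightarrow> letter list \<Rightarrow> letter list" where
  "swap i j = relabel (map_prod (transpose i j) id)"

definition flip :: "nat \<Rightarrow> letter list \<Rightarrow> letter list" where
  "flip i = relabel (\<lambda>a. if fst a = i then inv_letter a else a)"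

lemma letter_involution_swap:
  "i < n \<Longrightarrow> j < n \<Longrightarrow> letter_involution (map_prod (transpose i j) id)"
  by (auto simp: letter_involution_def inv_letter_def transpose_def map_prod_def split: prod.splits)

lemma letter_involution_flip: "letter_involution (\<lambda>a. if fst a = i then inv_letter a else a)"
  by (auto simp: letter_involution_def)

lemma swap_Aut: "i < n \<Longrightarrow> j < n \<Longrightarrow> swap i j \<in> carrier A"
  by (simp add: swap_def relabel_Aut letter_involution_swap)

lemma flip_Aut: "flip i \<in> carrier A"
  by (simp add: flip_def relabel_Aut letter_involution_flip)

lemma swap_letter: "fst a < n \<Longrightarrow> swap i j [a] = [(transpose i j (fst a), snd a)]"
  by (cases a) (simp add: swap_def relabel_letter)

lemma flip_letter: "fst a < n \<Longrightarrow> flip i [a] = [if fst a = i then inv_letter a else a]"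
  by (simp add: flip_def relabel_letter)

lemma swap_swap: "i < n \<Longrightarrow> j < n \<Longrightarrow> swap i j \<otimes>\<^bsub>A\<^esub> swap i j = \<one>\<^bsub>A\<^esub>"
  by (rule Aut_eqI)
    (auto simp: swap_Aut Aut_mult Aut_one letter_in_free_group swap_letter transpose_def)

lemma swap_conj:
  assumes "i < n" "j < n" "k < n" "i \<noteq> j" "i \<noteq> k" "j \<noteq> k"
  shows "swap j k \<otimes>\<^bsub>A\<^esub> swap i j = swap i k \<otimes>\<^bsub>A\<^esub> swap j k"
  by (rule Aut_eqI)
    (use assms in \<open>auto simp: swap_Aut Aut_mult letter_in_free_group swap_letter transpose_def\<close>)

lemma swap_commute: "swap i j = swap j i"
  by (simp add: swap_def transpose_commute)

text \<open>The three transvections compose to the quarter turn that sends \<open>x\<close> to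
  \<open>y\<close> and \<open>y\<close> to the inverse of \<open>x\<close>, as for elementary
  matrices of size 2; the transposition turns it into the inversion of \<open>y\<close>.\<close>

lemma flip_decomposition:
  assumes ij: "i < n" "j < n" "i \<noteq> j"
  defines "x \<equiv> (i, True)" and "y \<equiv> (j, True)"
  shows "flip j = swap i j \<otimes>\<^bsub>A\<^esub> (transv y x \<otimes>\<^bsub>A\<^esub>
    (transv (inv_letter x) y \<otimes>\<^bsub>A\<^esub> transv (inv_letter y) (inv_letter x)))" (is "_ = ?g")
proof (rule Aut_eqI)
  have xy: "fst x = i" "fst y = j" "x \<noteq> y" "y \<noteq> x" using ij by (auto simp: x_def y_def)
  have aut: "swap i j \<in> carrier A" "transv y x \<in> carrier A" "transv (inv_letter x) y \<in> carrier A"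
    "transv (inv_letter y) (inv_letter x) \<in> carrier A"
    using ij xy by (auto intro: swap_Aut transv_Aut)
  then show "?g \<in> carrier A" by simp
  show "flip j \<in> carrier A" by (rule flip_Aut)
  fix k assume k: "k < n"
  note ij' = ij ij(3)[symmetric]
  \<comment> \<open>At index \<open>i\<close> the inverse letter is tested, because the innermost
    transvection multiplies \<open>inv_letter x\<close>.\<close>
  define d where "d = (if k = i then inv_letter x else if k = j then y else (k, True))"
  have mult: "?g [d] = swap i j (transv y x (transv (inv_letter x) y
      (transv (inv_letter y) (inv_letter x) [d])))" if "fst d < n" for d
    using aut that by (simp add: Aut_mult Aut_closed letter_in_free_group)
  have inv: "transv (inv_letter x) y [inv_letter y] = [inv_letter y, x]"
    "transv y x [inv_letter x] = [inv_letter x, inv_letter y]"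
    using hom_inv_letter[OF Aut_hom[OF aut(3)], of y] hom_inv_letter[OF Aut_hom[OF aut(2)], of x]
      transv_same[of "inv_letter x" y] transv_same[of y x] ij' xy by (simp_all add: winv_def)
  have swap: "swap i j [inv_letter y] = [inv_letter x]" "swap i j [inv_letter x] = [inv_letter y]"
    using ij' by (simp_all add: swap_letter x_def y_def inv_letter_def)
  have "flip j [d] = ?g [d]"
  proof -
    consider "k = i" | "k = j" | "k \<noteq> i" "k \<noteq> j" by blast
    then show ?thesis
    proof cases
      case 1
      have "transv (inv_letter y) (inv_letter x) [inv_letter x] = [inv_letter y, inv_letter x]"
        using ij' xy by (simp add: transv_same)
      moreover have "transv (inv_letter x) y [inv_letter y, inv_letter x] = [inv_letter y]"
      proof -
        have "[inv_letter y, inv_letter x] \<in> carrier F"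
          using ij' xy by (simp add: carrier_free_group reduced_Cons)
        then show ?thesis
          using Aut_Cons[OF aut(3)] inv ij' xy by (simp add: transv_other letter_mult_def)
      qed
      moreover have "transv y x [inv_letter y] = [inv_letter y]"
        using ij' xy by (simp add: transv_other)
      ultimately have "?g [inv_letter x] = [inv_letter x]"
        using mult[of "inv_letter x"] ij' xy swap by simp
      then show ?thesis using 1 ij' xy by (simp add: d_def flip_letter)
    next
      case 2
      have "transv (inv_letter y) (inv_letter x) [y] = [y]"
        using ij' xy by (simp add: transv_other)
      moreover have "transv (inv_letter x) y [y] = [inv_letter x, y]"
        using ij' xy by (simp add: transv_same)
      moreover have "transv y x [inv_letter x, y] = [inv_letter x]"
      proof -
        have "[inv_letter x, y] \<in> carrier F"
          using ij' xy by (simp add: carrier_free_group reduced_Cons)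
        then show ?thesis
          using Aut_Cons[OF aut(2)] inv ij' xy by (simp add: transv_other letter_mult_def)
      qed
      ultimately have "?g [y] = [inv_letter y]"
        using mult[of y] ij' xy swap by simp
      then show ?thesis using 2 ij' xy by (simp add: d_def flip_letter)
    next
      case 3
      then show ?thesis
        using mult[of "(k, True)"] ij' xy k
        by (simp add: d_def flip_letter transv_other swap_letter)
    qed
  qed
  moreover have "fst d = k" using xy by (simp add: d_def)
  ultimately show "\<exists>d. fst d = k \<and> flip j [d] = ?g [d]" by blast
qed

end

section \<open>Homomorphisms killing a transposition\<close>

context
  fixes n :: nat and Q :: "('b, 'c) monoid_scheme" and h
  assumes n: "n \<ge> 3"
    and hom: "group_hom (Aut_free_group n) Q h"
    and swap01: "h (swap n 0 1) = \<one>\<^bsub>Q\<^esub>"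
begin

interpretation group_hom "Aut_free_group n" Q h by (rule hom)

section \<open>Transpositions, transvections and inversions are killed\<close>

lemma swap_trivial_step:
  assumes "i < n" "j < n" "k < n" "i \<noteq> j" "i \<noteq> k" "h (swap n i j) = \<one>\<^bsub>Q\<^esub>"
  shows "h (swap n i k) = \<one>\<^bsub>Q\<^esub>"
proof (cases "j = k")
  case False
  have "h (swap n j k) \<otimes>\<^bsub>Q\<^esub> h (swap n i j) = h (swap n i k) \<otimes>\<^bsub>Q\<^esub> h (swap n j k)"
    using arg_cong[OF swap_conj[of i n j k], of h] assms False by (simp add: swap_Aut)
  then show ?thesis using assms by (simp add: swap_Aut)
qed (use assms in simp)

lemma swap_trivial:
  assumes "i < n" "j < n" "i \<noteq> j"
  shows "h (swap n i j) = \<one>\<^bsub>Q\<^esub>"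
proof -
  have zero: "h (swap n 0 k) = \<one>\<^bsub>Q\<^esub>" if "k < n" "k \<noteq> 0" for k
    using swap_trivial_step[of 0 1 k] swap01 n that by simp
  show ?thesis
  proof (cases "i = 0")
    case False
    then have "h (swap n i 0) = \<one>\<^bsub>Q\<^esub>" using zero assms(1) swap_commute by metis
    then show ?thesis using swap_trivial_step[of i 0 j] assms False by simp
  qed (use zero assms in simp)
qed

lemma transv_conj:
  assumes "letter_involution n \<sigma>" "fst a < n" "fst b < n" "fst a \<noteq> fst b"
  shows "h (relabel n \<sigma>) \<otimes>\<^bsub>Q\<^esub> h (transv n a b) = h (transv n (\<sigma> a) (\<sigma> b)) \<otimes>\<^bsub>Q\<^esub> h (relabel n \<sigma>)"
  using arg_cong[OF relabel_transv[OF assms], of h] assms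
  by (simp add: transv_Aut relabel_Aut relabel_fst_neq letter_involution_less)

text \<open>The conjugating transposition is killed, so \<open>h\<close> does not notice the
  exchange of indices.\<close>

lemma transv_swap:
  assumes "k < n" "l < n" "k \<noteq> l" "fst a < n" "fst b < n" "fst a \<noteq> fst b"
  shows "h (transv n (map_prod (transpose k l) id a) (map_prod (transpose k l) id b)) = h (transv n a b)"
proof -
  note \<sigma> = letter_involution_swap[OF assms(1,2)]
  have "h (relabel n (map_prod (transpose k l) id)) = \<one>\<^bsub>Q\<^esub>"
    using swap_trivial[OF assms(1-3)] by (simp add: swap_def)
  then show ?thesis
    using transv_conj[OF \<sigma> assms(4-6)] transv_Aut[OF assms(4-6)]
      transv_Aut[OF letter_involution_less[OF \<sigma> assms(4)] letter_involution_less[OF \<sigma> assms(5)]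
        relabel_fst_neq[OF \<sigma> assms(6)]]
    by simp
qed

text \<open>As \<open>n\<close> is at least 3, a third index \<open>k\<close> exists. By symmetry
  the three transvections on \<open>i\<close>, \<open>j\<close>, \<open>k\<close> share one image
  \<open>r\<close>, and \<open>transv_relation\<close> becomes \<open>r r = r (r r)\<close>.\<close>

lemma transv_positive_trivial:
  assumes ij: "i < n" "j < n" "i \<noteq> j"
  shows "h (transv n (i, True) (j, True)) = \<one>\<^bsub>Q\<^esub>"
proof -
  obtain k where k: "k < n" "k \<noteq> i" "k \<noteq> j"
  proof -
    have "card {i, j} < card {..<n}" using n card_insert_le_m1[of 2 "{j}" i] by simp
    then obtain k where "k \<in> {..<n}" "k \<notin> {i, j}"
      by (meson card_mono finite.emptyI finite.insertI linorder_not_less subsetI)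
    then show thesis using that by auto
  qed
  let ?T = "\<lambda>i j. h (transv n (i, True) (j, True))"
  have "?T i k = ?T i j"
    using transv_swap[of j k "(i, True)" "(j, True)"] ij k by simp
  moreover have "?T j k = ?T i k"
    using transv_swap[of i j "(i, True)" "(k, True)"] ij k by simp
  moreover have "?T i j \<otimes>\<^bsub>Q\<^esub> ?T j k = ?T j k \<otimes>\<^bsub>Q\<^esub> (?T i j \<otimes>\<^bsub>Q\<^esub> ?T i k)"
    using arg_cong[OF transv_relation[of "(i, True)" n "(j, True)" "(k, True)"], of h] ij k
    by (simp add: transv_Aut)
  moreover have "?T i j \<in> carrier Q" using ij by (simp add: transv_Aut)
  ultimately show ?thesis by (simp add: H.m_assoc)
qed

text \<open>Conjugation by the inversion of a generator changes the sign of one letter. Conjugates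
  of trivial elements are trivial, so this works before the inversions are known to be
  killed.\<close>

lemma transv_trivial:
  assumes "fst a < n" "fst b < n" "fst a \<noteq> fst b"
  shows "h (transv n a b) = \<one>\<^bsub>Q\<^esub>"
proof -
  let ?f = "\<lambda>i a. if fst a = i then inv_letter a else a"
  have step: "h (transv n (?f i a) (?f i b)) = \<one>\<^bsub>Q\<^esub>"
    if "fst a < n" "fst b < n" "fst a \<noteq> fst b" "h (transv n a b) = \<one>\<^bsub>Q\<^esub>" for i a b
    using transv_conj[OF letter_involution_flip that(1-3), of i] that
    by (auto simp: transv_Aut relabel_Aut letter_involution_flip split: if_splits)
  obtain i s j t where [simp]: "a = (i, s)" "b = (j, t)" by (cases a, cases b) auto
  have ij: "i < n" "j < n" "i \<noteq> j" using assms by auto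
  have 1: "h (transv n (i, s) (j, True)) = \<one>\<^bsub>Q\<^esub>"
    using step[of "(i, True)" "(j, True)" i] transv_positive_trivial[OF ij] ij
    by (cases s) (auto simp: inv_letter_def)
  show ?thesis
    using step[of "(i, s)" "(j, True)" j] 1 ij
    by (cases t) (auto simp: inv_letter_def)
qed

lemma flip_trivial:
  assumes "j < n"
  shows "h (flip n j) = \<one>\<^bsub>Q\<^esub>"
proof -
  obtain i where i: "i < n" "i \<noteq> j" using n by (cases "j = 0") (auto intro: that[of 1] that[of 0])
  show ?thesis
    unfolding flip_decomposition[OF i(1) assms i(2)] using i assms
    by (simp add: swap_Aut transv_Aut swap_trivial transv_trivial)
qed

section \<open>Signed permutations are killed\<close>

lemma sign_change_trivial:
  assumes "f \<in> carrier (Aut_free_group n)" "\<And>i. i < n \<Longrightarrow> \<exists>s. f [(i, True)] = [(i, s)]"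
  shows "h f = \<one>\<^bsub>Q\<^esub>"
proof -
  \<comment> \<open>Generalised for the induction: only the first \<open>k\<close> generators may be
    inverted.\<close>
  have "h f = \<one>\<^bsub>Q\<^esub>"
    if "k \<le> n" "f \<in> carrier (Aut_free_group n)" "\<And>i. i < n \<Longrightarrow> \<exists>s. f [(i, True)] = [(i, s)]"
      "\<And>i. k \<le> i \<Longrightarrow> i < n \<Longrightarrow> f [(i, True)] = [(i, True)]" for k f
    using that
  proof (induction k arbitrary: f)
    case 0
    then have "f = \<one>\<^bsub>Aut_free_group n\<^esub>"
      by (intro Aut_eqI[where n = n]) (auto simp: Aut_one letter_in_free_group intro!: exI[of _ True])
    then show ?case by simp
  next
    case (Suc k)
    obtain s where s: "f [(k, True)] = [(k, s)]"
      using Suc.prems(3)[OF Suc_le_lessD[OF Suc.prems(1)]] by blast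
    show ?case
    proof (cases s)
      case True
      then have "f [(i, True)] = [(i, True)]" if "k \<le> i" "i < n" for i
        using Suc.prems(4)[of i] s that by (cases "i = k") auto
      then show ?thesis using Suc.IH[of f] Suc.prems by simp
    next
      case False
      \<comment> \<open>Precomposing with \<open>flip n k\<close> removes the sign at
        \<open>k\<close> and is invisible to \<open>h\<close>.\<close>
      let ?g = "f \<otimes>\<^bsub>Aut_free_group n\<^esub> flip n k"
      have k: "k < n" using Suc.prems(1) by simp
      have g: "?g [(i, True)] = (if i = k then [(k, True)] else f [(i, True)])" if "i < n" for i
      proof (cases "i = k")
        case True
        have "f [inv_letter (k, True)] = [(k, True)]"
          using hom_inv_letter[OF Aut_hom[OF Suc.prems(2)], of "(k, True)"] k s False
          by (simp add: inv_letter_def)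
        then show ?thesis
          using True k Suc.prems(2) by (simp add: Aut_mult flip_Aut flip_letter letter_in_free_group)
      next
        case False
        then show ?thesis
          using that Suc.prems(2) by (simp add: Aut_mult flip_Aut flip_letter letter_in_free_group)
      qed
      have "h ?g = \<one>\<^bsub>Q\<^esub>"
      proof (rule Suc.IH)
        show "?g [(i, True)] = [(i, True)]" if "k \<le> i" "i < n" for i
          using g[OF that(2)] Suc.prems(4)[of i] that by simp
        show "\<exists>s. ?g [(i, True)] = [(i, s)]" if "i < n" for i
          using g[OF that] Suc.prems(3)[OF that] by auto
      qed (use Suc.prems(1,2) flip_Aut in simp_all)
      then show ?thesis using Suc.prems(2) flip_trivial[OF k] by (simp add: flip_Aut)
    qed
  qed
  from this[of n f] assms show ?thesis by simp
qed

text \<open>Induction over a decomposition of \<open>p\<close> into transpositions: composing with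
  the matching \<open>swap\<close> cancels one of them without changing the image under
  \<open>h\<close>.\<close>

lemma permutation_trivial:
  assumes "p permutes {..<n}" "f \<in> carrier (Aut_free_group n)"
    "\<And>i. i < n \<Longrightarrow> \<exists>s. f [(i, True)] = [(p i, s)]"
  shows "h f = \<one>\<^bsub>Q\<^esub>"
  using assms(1) finite_lessThan[of n] assms(2,3)
proof (induction arbitrary: f rule: permutes_induct)
  case id
  then show ?case by (simp add: sign_change_trivial)
next
  case (swap a b p)
  let ?g = "swap n a b \<otimes>\<^bsub>Aut_free_group n\<^esub> f"
  have ab: "a < n" "b < n" "a \<noteq> b" using swap.hyps by auto
  have "h ?g = \<one>\<^bsub>Q\<^esub>"
  proof (rule swap.IH)
    show "?g \<in> carrier (Aut_free_group n)" using swap.prems(1) ab by (simp add: swap_Aut)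
    fix i assume i: "i < n"
    then obtain s where s: "f [(i, True)] = [(transpose a b (p i), s)]" using swap.prems(2) by auto
    have "transpose a b (p i) < n"
      using permutes_in_image[OF swap.hyps(4), of i] i ab by (auto simp: transpose_def)
    then have "?g [(i, True)] = [(p i, s)]"
      using s i ab swap.prems(1) by (simp add: Aut_mult swap_Aut letter_in_free_group swap_letter)
    then show "\<exists>s. ?g [(i, True)] = [(p i, s)]" by blast
  qed
  then show ?case using swap.prems(1) ab swap_trivial by (simp add: swap_Aut)
qed

lemma letter_map_trivial:
  assumes f: "f \<in> carrier (Aut_free_group n)" and letter: "\<And>i. i < n \<Longrightarrow> \<exists>a. f [(i, True)] = [a]"
  shows "h f = \<one>\<^bsub>Q\<^esub>"
proof -
  obtain g where g: "\<And>i. i < n \<Longrightarrow> f [(i, True)] = [g i]" using letter by metis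
  define p where "p i = (if i < n then fst (g i) else i)" for i
  have "inj_on p {..<n}"
  proof (rule inj_onI)
    fix i j assume "i \<in> {..<n}" "j \<in> {..<n}" "p i = p j"
    then have ij: "i < n" "j < n" "fst (g i) = fst (g j)" by (auto simp: p_def)
    have "g i = g j \<or> g i = inv_letter (g j)" using ij(3) fst_eq_letter by blast
    \<comment> \<open>Images with equal index agree up to inversion, so \<open>f\<close> would
      identify \<open>x\<^sub>i\<close> with \<open>x\<^sub>j\<close> or its inverse.\<close>
    then have "f [(i, True)] = f [(j, True)] \<or> f [(i, True)] = f [inv_letter (j, True)]"
      using g[OF ij(1)] g[OF ij(2)] hom_inv_letter[OF Aut_hom[OF f], of "(j, True)"] ij(2) by auto
    moreover have "inj_on f (carrier (free_group n))"
      using f by (auto simp: carrier_Aut bij_betw_def)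
    ultimately have "[(i, True)] = [(j, True)] \<or> [(i, True)] = [inv_letter (j, True)]"
      using ij(1,2) inj_on_eq_iff[of f "carrier (free_group n)"]
      by (simp add: letter_in_free_group)
    then show "i = j" by (auto simp: inv_letter_def)
  qed
  moreover have "p ` {..<n} \<subseteq> {..<n}"
  proof -
    have "[g i] \<in> carrier (free_group n)" if "i < n" for i
      using Aut_closed[OF f, of "[(i, True)]"] g[OF that] that by (simp add: letter_in_free_group)
    then show ?thesis by (auto simp: p_def letter_in_free_group)
  qed
  ultimately have "p permutes {..<n}"
    using endo_inj_surj[of "{..<n}" p] by (intro bij_imp_permutes) (auto simp: bij_betw_def p_def)
  then show ?thesis
    by (rule permutation_trivial[OF _ f]) (simp add: g p_def, metis prod.collapse)
qed

section \<open>Nielsen reduction\<close>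

lemma Aut_free_group_trivial:
  assumes "f \<in> carrier (Aut_free_group n)"
  shows "h f = \<one>\<^bsub>Q\<^esub>"
proof -
  let ?A = "Aut_free_group n"
  define \<Phi> where "\<Phi> g = (\<Sum>i<n. weight n (g [(i, True)]))" for g :: "letter list \<Rightarrow> letter list"
  obtain g where g: "g \<in> carrier ?A" "h g = h f"
    and least: "\<And>g'. g' \<in> carrier ?A \<Longrightarrow> h g' = h f \<Longrightarrow> \<Phi> g \<le> \<Phi> g'"
    using ex_has_least_nat[of "\<lambda>g. g \<in> carrier ?A \<and> h g = h f" f \<Phi>] assms by blast
  \<comment> \<open>\<open>\<Phi>\<close> sums over basis elements, while transvections may multiply
    inverse letters; the weights are the same.\<close>
  have weight_g: "weight n (g' [(fst b, True)]) = weight n (g' [b])"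
    if "fst b < n" "g' \<in> carrier ?A" for b g'
  proof (cases "snd b")
    case False
    then have "b = inv_letter (fst b, True)" by (cases b) (simp add: inv_letter_def)
    then show ?thesis
      using hom_inv_letter[OF Aut_hom[OF that(2)], of "(fst b, True)"] that(1) by (metis fst_conv weight_winv)
  qed (cases b, simp)
  have minimal: "weight n (g [b]) \<le> weight n (word_mult (g [a]) (g [b]))"
    if ab: "fst a < n" "fst b < n" "fst a \<noteq> fst b" for a b
  proof -
    let ?g = "g \<otimes>\<^bsub>?A\<^esub> transv n a b"
    note T = transv_Aut[OF ab]
    have "[a, b] \<in> carrier (free_group n)"
      using ab ab(3)[symmetric] by (simp add: carrier_free_group reduced_Cons)
    then have gb: "?g [b] = word_mult (g [a]) (g [b])"
      using Aut_Cons[OF g(1)] g(1) T ab by (simp add: Aut_mult letter_in_free_group transv_same)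
    have other: "?g [(i, True)] = g [(i, True)]" if "i < n" "i \<noteq> fst b" for i
      using that g(1) T ab by (simp add: Aut_mult letter_in_free_group transv_other)
    \<comment> \<open>The transvection keeps the image under \<open>h\<close> and changes only the
      summand at \<open>fst b\<close>, so minimality of the sum passes to that summand.\<close>
    have "\<Phi> g \<le> \<Phi> ?g"
      using least[of ?g] g T transv_trivial[OF ab] assms by simp
    then have "weight n (g [(fst b, True)]) \<le> weight n (?g [(fst b, True)])"
      using ab(2) other by (simp add: \<Phi>_def sum.remove[of "{..<n}" "fst b"])
    then show ?thesis using weight_g[OF ab(2)] g(1) T gb by simp
  qed
  have closed: "g [a] \<in> carrier (free_group n)" if "fst a < n" for a
    using Aut_closed[OF g(1)] that letter_in_free_group by blast
  have expanding: "length w \<le> length (g w)" if w: "w \<in> carrier (free_group n)" for w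
    unfolding hom_foldr[OF Aut_hom[OF g(1)] w]
  proof (rule length_product_ge[where L = "{a. fst a < n}"])
    show "reduced (g [a])" if "a \<in> {a. fst a < n}" for a
      using closed that by (simp add: carrier_free_group)
    show "reduced w" "set w \<subseteq> {a. fst a < n}" using w by (auto simp: carrier_free_group)
    show "cancellation (g [a]) (g [b]) + cancellation (g [b]) (g [d]) < length (g [b])"
      if "a \<in> {a. fst a < n}" "b \<in> {a. fst a < n}" "d \<in> {a. fst a < n}"
        "b \<noteq> inv_letter a" "d \<noteq> inv_letter b" for a b d
    proof (rule minimal_small_cancellation[where n = n and v = "\<lambda>a. g [a]"])
      show "g [a] \<noteq> []" if "a \<in> {a. fst a < n}" for a
      proof
        assume "g [a] = []"
        moreover have "g [] = []" using hom_Nil[OF Aut_hom[OF g(1)]] .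
        moreover have "inj_on g (carrier (free_group n))"
          using g(1) by (auto simp: carrier_Aut bij_betw_def)
        ultimately show False
          using that by (auto dest: inj_onD[of _ _ "[a]" "[]"] simp: letter_in_free_group carrier_free_group reduced_Cons)
      qed
      show "g [inv_letter a] = winv (g [a])" if "a \<in> {a. fst a < n}" for a
        using that hom_inv_letter[OF Aut_hom[OF g(1)]] by simp
      show "fst x < n" if "a \<in> {a. fst a < n}" "x \<in> set (g [a])" for a x
        using that closed[of a] by (simp add: carrier_free_group)
      show "reduced (g [a])" if "a \<in> {a. fst a < n}" for a
        using closed that by (simp add: carrier_free_group)
      show "weight n (g [b]) \<le> weight n (word_mult (g [a]) (g [b]))"
        if "a \<in> {a. fst a < n}" "b \<in> {a. fst a < n}" "fst a \<noteq> fst b" for a b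
        using minimal that by simp
    qed (fact that)+
  qed
  let ?k = "inv\<^bsub>?A\<^esub> g"
  have "\<exists>a. ?k [(i, True)] = [a]" if "i < n" for i
  proof -
    let ?w = "?k [(i, True)]"
    have mem: "[(i, True)] \<in> carrier (free_group n)" using that by (simp add: letter_in_free_group)
    have w: "?w \<in> carrier (free_group n)" using Aut_closed[OF _ mem] g(1) by simp
    have gw: "g ?w = [(i, True)]"
      using Aut_mult[OF g(1) _ mem, of ?k] g(1) Aut_one[OF mem] by simp
    \<comment> \<open>\<open>g\<close> does not shorten words, yet sends \<open>?w\<close> to a
      single letter.\<close>
    then have "length ?w \<le> 1" using expanding[OF w] by simp
    moreover have "?w \<noteq> []" using gw hom_Nil[OF Aut_hom[OF g(1)]] by auto
    ultimately show ?thesis by (cases ?w) auto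
  qed
  then have "h ?k = \<one>\<^bsub>Q\<^esub>" using g(1) by (intro letter_map_trivial) simp_all
  then have "h g = \<one>\<^bsub>Q\<^esub>" using g(1) by (metis G.inv_closed G.inv_inv H.inv_one hom_inv)
  then show ?thesis using g(2) by simp
qed

end

section \<open>Normal closures in the automorphism group and its quotients\<close>

lemma swap_ord:
  assumes "i < n" "j < n" "i \<noteq> j"
  shows "group.ord (Aut_free_group n) (swap n i j) = 2"
proof -
  interpret A: group "Aut_free_group n" by (rule group_Aut_free_group)
  have "swap n i j [(i, True)] \<noteq> \<one>\<^bsub>Aut_free_group n\<^esub> [(i, True)]"
    using assms by (simp add: swap_letter Aut_one letter_in_free_group)
  then have "A.ord (swap n i j) \<noteq> 1"
    using A.ord_eq_1[OF swap_Aut] assms by auto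
  moreover have "A.ord (swap n i j) dvd 2"
    using A.pow_eq_id[OF swap_Aut, of i j 2] assms swap_swap by (simp add: numeral_2_eq_2 swap_Aut)
  ultimately show ?thesis by (metis primes_dvd_imp_eq two_is_prime_nat prime_nat_iff)
qed

text \<open>Turns triviality under the projection into membership in \<open>N\<close>, so that
  statements about homomorphisms yield statements about normal subgroups.\<close>

lemma kernel_of_projection:
  assumes "N \<lhd> G" "x \<in> carrier G"
  shows "N #>\<^bsub>G\<^esub> x = \<one>\<^bsub>G Mod N\<^esub> \<longleftrightarrow> x \<in> N"
proof -
  interpret normal N G by fact
  show ?thesis
    using assms(2) by (metis FactGroup_def coset_join1 coset_join2 monoid.select_convs(2) subgroup_axioms subset)
qed

lemma normal_closure_eqI:
  assumes "group G" "a \<in> carrier G"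
    and trivial: "\<And>M. M \<lhd> G \<Longrightarrow> a \<in> M \<Longrightarrow> carrier G \<subseteq> M"
  shows "normal_closure G a = carrier G"
proof
  show "normal_closure G a \<subseteq> carrier G"
    using normal_closure_normal[OF assms(1,2)] normal_imp_subgroup subgroup.subset by blast
  show "carrier G \<subseteq> normal_closure G a"
    using trivial by (auto simp: normal_closure_def)
qed

theorem propositionD:
  fixes n :: nat
  assumes "n \<ge> 3"
  shows "(\<exists>a\<in>carrier (Aut_free_group n).
            group.ord (Aut_free_group n) a = 2 \<and>
            normal_closure (Aut_free_group n) a = carrier (Aut_free_group n)) \<and>
         (\<forall>N. N \<lhd> Aut_free_group n \<longrightarrow>
            (\<exists>q\<in>carrier (Aut_free_group n Mod N).
               (N \<noteq> carrier (Aut_free_group n) \<longrightarrow>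
                  group.ord (Aut_free_group n Mod N) q = 2) \<and>
               normal_closure (Aut_free_group n Mod N) q = carrier (Aut_free_group n Mod N)))"
proof -
  let ?A = "Aut_free_group n" and ?a = "swap n 0 1"
  interpret A: group ?A by (rule group_Aut_free_group)
  have a: "?a \<in> carrier ?A" using assms by (simp add: swap_Aut)
  have ord_a: "A.ord ?a = 2" using assms by (simp add: swap_ord)
  have whole: "carrier ?A \<subseteq> M" if M: "M \<lhd> ?A" "?a \<in> M" for M
  proof
    fix f assume f: "f \<in> carrier ?A"
    \<comment> \<open>The projection modulo \<open>M\<close> kills \<open>?a\<close>, hence
      everything.\<close>
    have "group_hom ?A (?A Mod M) (\<lambda>x. M #>\<^bsub>?A\<^esub> x)"
      using normal.r_coset_hom_Mod[OF M(1)] normal.factorgroup_is_group[OF M(1)] A.is_group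
      by (simp add: group_hom_def group_hom_axioms_def)
    then have "M #>\<^bsub>?A\<^esub> f = \<one>\<^bsub>?A Mod M\<^esub>"
      using Aut_free_group_trivial[OF assms] kernel_of_projection[OF M(1) a] M(2) f by blast
    then show "f \<in> M" using kernel_of_projection[OF M(1) f] by simp
  qed
  have "\<exists>q\<in>carrier (?A Mod N). (N \<noteq> carrier ?A \<longrightarrow> group.ord (?A Mod N) q = 2) \<and>
      normal_closure (?A Mod N) q = carrier (?A Mod N)" if N: "N \<lhd> ?A" for N
  proof (intro bexI conjI impI)
    \<comment> \<open>The image of the transposition serves for every quotient; by
      \<open>whole\<close> it is nontrivial unless \<open>N\<close> is the whole group.\<close>
    let ?q = "N #>\<^bsub>?A\<^esub> ?a"
    interpret Q: group "?A Mod N" by (rule normal.factorgroup_is_group[OF N])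
    interpret q: group_hom ?A "?A Mod N" "\<lambda>x. N #>\<^bsub>?A\<^esub> x"
      using normal.r_coset_hom_Mod[OF N] by unfold_locales
    show q: "?q \<in> carrier (?A Mod N)" using q.hom_closed[OF a] .
    show "Q.ord ?q = 2" if "N \<noteq> carrier ?A"
    proof -
      have "?a \<notin> N"
        using that whole[OF N] normal_imp_subgroup[OF N] subgroup.subset by blast
      then have "Q.ord ?q \<noteq> 1" using Q.ord_eq_1[OF q] kernel_of_projection[OF N a] by simp
      moreover have "Q.ord ?q dvd 2"
      proof -
        have "?q [^]\<^bsub>?A Mod N\<^esub> (2::nat) = N #>\<^bsub>?A\<^esub> (?a [^]\<^bsub>?A\<^esub> (2::nat))"
          using q.hom_nat_pow[OF a] by simp
        also have "\<dots> = \<one>\<^bsub>?A Mod N\<^esub>" using A.pow_ord_eq_1[OF a] ord_a q.hom_one by simp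
        finally show ?thesis using Q.pow_eq_id[OF q] by blast
      qed
      ultimately show ?thesis by (metis primes_dvd_imp_eq two_is_prime_nat prime_nat_iff)
    qed
    show "normal_closure (?A Mod N) ?q = carrier (?A Mod N)"
    proof (rule normal_closure_eqI[OF Q.is_group q])
      fix M assume M: "M \<lhd> ?A Mod N" "?q \<in> M"
      have "group_hom (?A Mod N) (?A Mod N Mod M) (\<lambda>x. M #>\<^bsub>?A Mod N\<^esub> x)"
        using normal.r_coset_hom_Mod[OF M(1)] normal.factorgroup_is_group[OF M(1)] Q.is_group
        by (simp add: group_hom_def group_hom_axioms_def)
      \<comment> \<open>The composite projection onto the iterated quotient kills \<open>?a\<close>,
        so it is trivial on all of \<open>?A\<close>.\<close>
      then have "group_hom ?A (?A Mod N Mod M) (\<lambda>x. M #>\<^bsub>?A Mod N\<^esub> (N #>\<^bsub>?A\<^esub> x))"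
        using Group.hom_compose[OF q.homh] A.is_group
        by (auto simp: group_hom_def group_hom_axioms_def comp_def)
      then have "M #>\<^bsub>?A Mod N\<^esub> (N #>\<^bsub>?A\<^esub> f) = \<one>\<^bsub>?A Mod N Mod M\<^esub>" if "f \<in> carrier ?A" for f
        using Aut_free_group_trivial[OF assms] kernel_of_projection[OF M(1) q] M(2) that by blast
      then have "N #>\<^bsub>?A\<^esub> f \<in> M" if "f \<in> carrier ?A" for f
        using kernel_of_projection[OF M(1) q.hom_closed] that by blast
      then show "carrier (?A Mod N) \<subseteq> M"
        by (auto simp: FactGroup_def RCOSETS_def)
    qed
  qed
  moreover have "normal_closure ?A ?a = carrier ?A"
    using normal_closure_eqI[OF A.is_group a] whole by blast
  ultimately show ?thesis using a ord_a by blast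
qed

end
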